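(* There exists a one-sided error distribution-free tester for additivity of measurable functions $f\colon\mathbb{R}^n\to\mathbb{R}$ that makes $O\left(\frac{1}{\varepsilon}\log\frac{1}{\varepsilon}\right)$ queries (a bound independent of $n$).
   Context: A function $f\colon\mathbb{R}^n\to\mathbb{R}$ is additive if $f(x+y)=f(x)+f(y)$ for all $x,y\in\mathbb{R}^n$. For a distribution $\mathcal{D}$ on $\mathbb{R}^n$ and $\varepsilon>0$, a measurable $f$ is $\varepsilon$-far from a property $P$ with respect to $\mathcal{D}$ if $\Pr_{x\sim\mathcal{D}}[f(x)\neq g(x)]>\varepsilon$ for every measurable $g\colon\mathbb{R}^n\to\mathbb{R}$ satisfying $P$. A distribution-free tester for $P$ is a randomized algorithm that is given query access to a measurable $f\colon\mathbb{R}^n\to\mathbb{R}$, sampling access to an unknown distribution $\mathcal{D}$ over $\mathbb{R}^n$ and to the standard Gaussian $\mathcal{N}(0,I)$, and a parameter $\varepsilon>0$; it must accept with probability at least $2/3$ when $f$ satisfies $P$ and reject with probability at least $2/3$ when $f$ is $\varepsilon$-far from $P$ with respect to $\mathcal{D}$. It has one-sided error if it accepts every $f$ satisfying $P$ with probability $1$. The query complexity counts queries to $f$. *)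

theory Defs
  imports
    "HOL-Probability.Probability"
    "HOL-Library.Extended_Nat"
    "HOL-Library.Landau_Symbols"
begin

text \<open>
  The dimension \<open>n\<close> has to be quantified inside the statement, after the query bound, so points of
  \<open>\<real>\<^sup>n\<close> are functions on the indices below \<open>n\<close> (extended by \<open>undefined\<close>) and \<open>\<real>\<^sup>n\<close> with its Borel
  sigma-algebra is a finite product of copies of \<open>borel\<close>.
\<close>

type_synonym point = "nat \<Rightarrow> real"

definition Rn :: "nat \<Rightarrow> point measure" where
  "Rn n = Pi\<^sub>M {..<n} (\<lambda>_. borel)"

definition point_add :: "nat \<Rightarrow> point \<Rightarrow> point \<Rightarrow> point" where
  "point_add n x y = (\<lambda>i\<in>{..<n}. x i + y i)"

definition std_gaussian :: "nat \<Rightarrow> point measure" where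
  "std_gaussian n = Pi\<^sub>M {..<n} (\<lambda>_. std_normal_distribution)"

definition additive_fun :: "nat \<Rightarrow> (point \<Rightarrow> real) \<Rightarrow> bool" where
  "additive_fun n f \<longleftrightarrow>
     (\<forall>x\<in>space (Rn n). \<forall>y\<in>space (Rn n). f (point_add n x y) = f x + f y)"

definition eps_far ::
    "nat \<Rightarrow> ((point \<Rightarrow> real) \<Rightarrow> bool) \<Rightarrow> point measure \<Rightarrow> real \<Rightarrow> (point \<Rightarrow> real) \<Rightarrow> bool" where
  "eps_far n P D \<epsilon> f \<longleftrightarrow>
     (\<forall>g \<in> borel_measurable (Rn n). P g \<longrightarrow> measure D {x \<in> space D. f x \<noteq> g x} > \<epsilon>)"

text \<open>
  A randomized oracle algorithm is a well-founded, possibly infinitely branching, decision tree: it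
  may adaptively query the unknown function at a point, draw a fresh sample from the unknown
  distribution or from the standard Gaussian, or toss a fair coin, and finally accepts or rejects.
  Computation between these steps is exact and not charged for.
\<close>

datatype algorithm =
    Accept
  | Reject
  | Query point "real \<Rightarrow> algorithm"
  | Sample "point \<Rightarrow> algorithm"
  | Gaussian "point \<Rightarrow> algorithm"
  | Coin "bool \<Rightarrow> algorithm"

text \<open>The law of the verdict (\<open>True\<close> for acceptance), in the Giry monad; all draws are independent.\<close>

primrec verdict ::
    "nat \<Rightarrow> (point \<Rightarrow> real) \<Rightarrow> point measure \<Rightarrow> algorithm \<Rightarrow> bool measure" where
  "verdict n f D Accept = return (count_space UNIV) True"
| "verdict n f D Reject = return (count_space UNIV) False"
| "verdict n f D (Query x k) = verdict n f D (k (f x))"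
| "verdict n f D (Sample k) = D \<bind> (\<lambda>x. verdict n f D (k x))"
| "verdict n f D (Gaussian k) = std_gaussian n \<bind> (\<lambda>x. verdict n f D (k x))"
| "verdict n f D (Coin k) = measure_pmf (bernoulli_pmf (1/2)) \<bind> (\<lambda>b. verdict n f D (k b))"

text \<open>
  An algorithm is well-formed on \<open>\<real>\<^sup>n\<close> if it queries only points of \<open>\<real>\<^sup>n\<close> and if its behaviour after
  drawing a sample depends measurably on that sample, whatever the function and the distribution
  are. Without the second requirement the monadic bind above would not be meaningful.
\<close>

primrec well_formed :: "nat \<Rightarrow> algorithm \<Rightarrow> bool" where
  "well_formed n Accept \<longleftrightarrow> True"
| "well_formed n Reject \<longleftrightarrow> True"
| "well_formed n (Query x k) \<longleftrightarrow> x \<in> space (Rn n) \<and> (\<forall>y. well_formed n (k y))"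
| "well_formed n (Sample k) \<longleftrightarrow>
     (\<forall>x\<in>space (Rn n). well_formed n (k x)) \<and>
     (\<forall>f \<in> borel_measurable (Rn n). \<forall>D \<in> space (prob_algebra (Rn n)).
        (\<lambda>x. verdict n f D (k x)) \<in> Rn n \<rightarrow>\<^sub>M prob_algebra (count_space UNIV))"
| "well_formed n (Gaussian k) \<longleftrightarrow>
     (\<forall>x\<in>space (Rn n). well_formed n (k x)) \<and>
     (\<forall>f \<in> borel_measurable (Rn n). \<forall>D \<in> space (prob_algebra (Rn n)).
        (\<lambda>x. verdict n f D (k x)) \<in> Rn n \<rightarrow>\<^sub>M prob_algebra (count_space UNIV))"
| "well_formed n (Coin k) \<longleftrightarrow> (\<forall>b. well_formed n (k b))"

text \<open>Worst-case number of queries along any branch; samples and coins are free.\<close>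

primrec query_complexity :: "algorithm \<Rightarrow> enat" where
  "query_complexity Accept = 0"
| "query_complexity Reject = 0"
| "query_complexity (Query x k) = eSuc (SUP y. query_complexity (k y))"
| "query_complexity (Sample k) = (SUP x. query_complexity (k x))"
| "query_complexity (Gaussian k) = (SUP x. query_complexity (k x))"
| "query_complexity (Coin k) = (SUP b. query_complexity (k b))"

definition distribution_free_tester ::
    "nat \<Rightarrow> ((point \<Rightarrow> real) \<Rightarrow> bool) \<Rightarrow> (real \<Rightarrow> algorithm) \<Rightarrow> bool" where
  "distribution_free_tester n P A \<longleftrightarrow>
     (\<forall>\<epsilon>>0. well_formed n (A \<epsilon>) \<and>
        (\<forall>f \<in> borel_measurable (Rn n). \<forall>D \<in> space (prob_algebra (Rn n)).
           (P f \<longrightarrow> measure (verdict n f D (A \<epsilon>)) {True} \<ge> 2/3) \<and>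
           (eps_far n P D \<epsilon> f \<longrightarrow> measure (verdict n f D (A \<epsilon>)) {False} \<ge> 2/3)))"

definition one_sided_error ::
    "nat \<Rightarrow> ((point \<Rightarrow> real) \<Rightarrow> bool) \<Rightarrow> (real \<Rightarrow> algorithm) \<Rightarrow> bool" where
  "one_sided_error n P A \<longleftrightarrow>
     (\<forall>\<epsilon>>0. \<forall>f \<in> borel_measurable (Rn n). \<forall>D \<in> space (prob_algebra (Rn n)).
        P f \<longrightarrow> measure (verdict n f D (A \<epsilon>)) {True} = 1)"

lemma std_gaussian_in_prob_algebra: "std_gaussian n \<in> space (prob_algebra (Rn n))"
proof -
  have *: "prob_space std_normal_distribution"
    by (simp add: prob_space_normal_density)
  have "prob_space (std_gaussian n)"
    unfolding std_gaussian_def by (intro prob_space_PiM *)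
  moreover have "sets (std_gaussian n) = sets (Rn n)"
    unfolding std_gaussian_def Rn_def by (intro sets_PiM_cong) auto
  ultimately show ?thesis by (simp add: space_prob_algebra)
qed

lemma bind_in_prob_algebra:
  assumes "D \<in> space (prob_algebra M)" "K \<in> M \<rightarrow>\<^sub>M prob_algebra N"
  shows "D \<bind> K \<in> space (prob_algebra N)"
  using prob_space_bind'[OF assms] sets_bind'[OF assms] by (simp add: space_prob_algebra)

lemma verdict_in_prob_algebra:
  assumes f: "f \<in> borel_measurable (Rn n)" and D: "D \<in> space (prob_algebra (Rn n))"
  shows "well_formed n T \<Longrightarrow> verdict n f D T \<in> space (prob_algebra (count_space UNIV))"
proof (induction T)
  case (Sample k)
  then show ?case
    using f D by (auto intro!: bind_in_prob_algebra[where M = "Rn n"])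
next
  case (Gaussian k)
  then show ?case
    using f D std_gaussian_in_prob_algebra[of n]
    by (auto intro!: bind_in_prob_algebra[where M = "Rn n"])
next
  case (Coin k)
  have "measure_pmf (bernoulli_pmf (1/2)) \<in> space (prob_algebra (count_space UNIV))"
    by (simp add: space_prob_algebra measure_pmf.prob_space_axioms)
  with Coin show ?case
    by (auto intro!: bind_in_prob_algebra[where M = "count_space UNIV"])
next
  case (Query x k)
  then show ?case by auto
qed (auto simp: space_prob_algebra prob_space_return)

end

theory Submission
  imports Defs
begin

text \<open>
  One round of the tester draws Gaussian \<open>x, y\<close> and \<open>p\<close> from the unknown distribution, and checks
  \<open>f x + f y = f (x + y)\<close> and \<open>f p = k (f (x + p / k) - f x)\<close>, where the natural number \<open>k\<close> is so large
  that \<open>p / k\<close> has \<open>\<ell>\<^sub>1\<close>-norm at most \<open>1/100\<close>. A shift by \<open>q\<close> moves the standard Gaussian by at most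
  \<open>2 \<bar>q\<bar>\<^sub>1\<close> in total variation, in every dimension. Hence, if the first check fails with probability at
  most \<open>1/10\<close>, then for every small \<open>q\<close> the difference \<open>f (x + q) - f x\<close> has a majority value \<open>\<phi> q\<close>, and
  \<open>\<phi>\<close> is additive near \<open>0\<close>. So \<open>g p = k \<phi> (p / k)\<close> is additive and measurable, and the second check fails
  with probability at least \<open>3/4\<close> over \<open>x\<close> whenever \<open>f p \<noteq> g p\<close>. If \<open>f\<close> is \<open>\<epsilon>\<close>-far from additive, each
  round thus rejects with probability at least \<open>\<epsilon> / 10\<close>, and \<open>\<lceil>20 / \<epsilon>\<rceil>\<close> rounds of five queries suffice;
  no logarithmic factor is needed.
\<close>

subsection \<open>Shifts of the standard Gaussian\<close>

lemma sets_std_gaussian [measurable_cong]: "sets (std_gaussian n) = sets (Rn n)"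
  using std_gaussian_in_prob_algebra[of n] by (simp add: space_prob_algebra)

lemma prob_space_std_gaussian: "prob_space (std_gaussian n)"
  using std_gaussian_in_prob_algebra[of n] by (simp add: space_prob_algebra)

text \<open>For \<open>\<bar>a\<bar> \<le> 1\<close> the densities are compared pointwise:
  \<open>r x\<close> exceeds \<open>r (x + a)\<close> by at most \<open>w x\<close>, whose integral
  is at most \<open>2 * \<bar>a\<bar>\<close>, and translation invariance of Lebesgue measure does
  the rest. For larger shifts the error term alone exceeds the total mass.\<close>

lemma std_normal_shift:
  fixes h :: "real \<Rightarrow> ennreal"
  assumes [measurable]: "h \<in> borel_measurable borel" and h1: "\<And>x. h x \<le> 1"
  shows "(\<integral>\<^sup>+x. h (x + a) \<partial>std_normal_distribution)
       \<le> (\<integral>\<^sup>+x. h x \<partial>std_normal_distribution) + ennreal (2 * \<bar>a\<bar>)"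
proof (cases "\<bar>a\<bar> \<le> 1")
  case False
  interpret prob_space std_normal_distribution by (rule prob_space_normal_density) simp
  have "(\<integral>\<^sup>+x. h (x + a) \<partial>std_normal_distribution) \<le> (\<integral>\<^sup>+x. 1 \<partial>std_normal_distribution)"
    by (intro nn_integral_mono) (simp add: h1)
  also have "\<dots> = ennreal 1"
    using emeasure_space_1 by simp
  also have "\<dots> \<le> ennreal (2 * \<bar>a\<bar>)"
    using False by (intro ennreal_leI) simp
  finally show ?thesis
    by (simp add: add_increasing)
next
  case True
  define r where "r = (\<lambda>x. std_normal_density x)"
  have r0: "r x \<ge> 0" for x by (simp add: r_def)
  have [measurable]: "r \<in> borel_measurable borel" by (simp add: r_def)
  \<comment> \<open>With t = a x + a^2 / 2 the density ratio is exp (-t) \<ge> 1 - t. Replacing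
    \<open>\<bar>x\<bar>\<close> by the larger (1 + x^2) / 2 leaves only the moments of order 0 and
    2 to integrate.\<close>
  define w where "w = (\<lambda>x. r x * (\<bar>a\<bar> / 2 * (1 + x\<^sup>2) + a\<^sup>2 / 2))"
  have ratio: "r x \<le> r (x + a) + w x" for x
  proof -
    have "r (x + a) = r x * exp (- (a * x + a\<^sup>2 / 2))"
      by (simp add: r_def std_normal_density_def power2_eq_square algebra_simps add_divide_distrib
          flip: exp_add)
    moreover have "exp (- (a * x + a\<^sup>2 / 2)) \<ge> 1 - (a * x + a\<^sup>2 / 2)"
      using exp_ge_add_one_self[of "- (a * x + a\<^sup>2 / 2)"] by linarith
    moreover have "a * x \<le> \<bar>a\<bar> / 2 * (1 + x\<^sup>2)"
    proof -
      have "\<bar>x\<bar> \<le> (1 + x\<^sup>2) / 2"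
        using sum_squares_ge_zero[of "\<bar>x\<bar> - 1" 0]
        by (simp add: power2_eq_square algebra_simps flip: abs_mult)
      then have "\<bar>a\<bar> * \<bar>x\<bar> \<le> \<bar>a\<bar> * ((1 + x\<^sup>2) / 2)"
        by (intro mult_left_mono) auto
      moreover have "a * x \<le> \<bar>a\<bar> * \<bar>x\<bar>" by (simp flip: abs_mult)
      ultimately show ?thesis by simp
    qed
    ultimately have "r (x + a) \<ge> r x * (1 - (\<bar>a\<bar> / 2 * (1 + x\<^sup>2) + a\<^sup>2 / 2))"
      using r0[of x] by (smt (verit, best) mult_left_mono)
    then show ?thesis by (simp add: w_def algebra_simps)
  qed
  have w0: "w x \<ge> 0" for x unfolding w_def using r0[of x] by (intro mult_nonneg_nonneg) auto
  have w_int: "has_bochner_integral lborel w (\<bar>a\<bar> + a\<^sup>2 / 2)"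
  proof -
    have "has_bochner_integral lborel r 1"
      using std_normal_moment_even[of 0] by (simp add: r_def)
    moreover have "has_bochner_integral lborel (\<lambda>x. r x * x\<^sup>2) 1"
      using std_normal_moment_even[of 1] by (simp add: r_def)
    ultimately have "has_bochner_integral lborel
        (\<lambda>x. (\<bar>a\<bar> / 2 + a\<^sup>2 / 2) * r x + \<bar>a\<bar> / 2 * (r x * x\<^sup>2))
        ((\<bar>a\<bar> / 2 + a\<^sup>2 / 2) * 1 + \<bar>a\<bar> / 2 * 1)"
      by (intro has_bochner_integral_add has_bochner_integral_mult_right)
    then show ?thesis
      by (simp add: w_def algebra_simps cong: has_bochner_integral_cong)
  qed
  have "(\<integral>\<^sup>+x. h (x + a) \<partial>std_normal_distribution) = (\<integral>\<^sup>+x. ennreal (r x) * h (x + a) \<partial>lborel)"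
    by (simp add: nn_integral_density r_def)
  also have "\<dots> \<le> (\<integral>\<^sup>+x. ennreal (r (x + a)) * h (x + a) + ennreal (w x) \<partial>lborel)"
  proof (intro nn_integral_mono)
    fix x
    have "ennreal (r x) * h (x + a) \<le> (ennreal (r (x + a)) + ennreal (w x)) * h (x + a)"
      using ratio[of x] by (intro mult_right_mono)
        (auto simp: r0 w0 simp flip: ennreal_plus intro!: ennreal_leI)
    also have "\<dots> \<le> ennreal (r (x + a)) * h (x + a) + ennreal (w x)"
      using mult_left_mono[OF h1[of "x + a"], of "ennreal (w x)"]
      by (simp add: distrib_right add_left_mono)
    finally show "ennreal (r x) * h (x + a) \<le> ennreal (r (x + a)) * h (x + a) + ennreal (w x)" .
  qed
  also have "\<dots> = (\<integral>\<^sup>+x. ennreal (r (x + a)) * h (x + a) \<partial>lborel) + (\<integral>\<^sup>+x. ennreal (w x) \<partial>lborel)"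
    by (intro nn_integral_add) (auto simp: w_def)
  also have "(\<integral>\<^sup>+x. ennreal (r (x + a)) * h (x + a) \<partial>lborel) = (\<integral>\<^sup>+x. ennreal (r x) * h x \<partial>lborel)"
    using nn_integral_real_affine[of "\<lambda>x. ennreal (r x) * h x" 1 a] by (simp add: add.commute)
  also have "\<dots> = (\<integral>\<^sup>+x. h x \<partial>std_normal_distribution)"
    by (simp add: nn_integral_density r_def)
  also have "(\<integral>\<^sup>+x. ennreal (w x) \<partial>lborel) = ennreal (\<bar>a\<bar> + a\<^sup>2 / 2)"
    using w_int w0 by (simp add: has_bochner_integral_iff nn_integral_eq_integral)
  also have "\<dots> \<le> ennreal (2 * \<bar>a\<bar>)"
  proof (intro ennreal_leI)
    have "a\<^sup>2 \<le> \<bar>a\<bar> * 1" using True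
      by (metis abs_ge_zero mult_left_mono power2_abs power2_eq_square)
    then show "\<bar>a\<bar> + a\<^sup>2 / 2 \<le> 2 * \<bar>a\<bar>" by simp
  qed
  finally show ?thesis by (simp add: add_left_mono)
qed

section \<open>Vector operations and the l1 norm on points\<close>

lemma measurable_point_add [measurable (raw)]:
  assumes [measurable]: "g \<in> M \<rightarrow>\<^sub>M Rn n" "h \<in> M \<rightarrow>\<^sub>M Rn n"
  shows "(\<lambda>x. point_add n (g x) (h x)) \<in> M \<rightarrow>\<^sub>M Rn n"
proof -
  have "(\<lambda>x. g x i) \<in> borel_measurable M" "(\<lambda>x. h x i) \<in> borel_measurable M" if "i < n" for i
    using assms that unfolding Rn_def
    by (auto intro: measurable_compose[OF _ measurable_component_singleton])
  then show ?thesis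
    unfolding Rn_def point_add_def by (intro measurable_restrict) auto
qed

definition point_scale :: "nat \<Rightarrow> real \<Rightarrow> point \<Rightarrow> point" where
  "point_scale n c x = (\<lambda>i\<in>{..<n}. c * x i)"

lemma measurable_point_scale [measurable (raw)]:
  assumes [measurable]: "c \<in> borel_measurable M" "h \<in> M \<rightarrow>\<^sub>M Rn n"
  shows "(\<lambda>x. point_scale n (c x) (h x)) \<in> M \<rightarrow>\<^sub>M Rn n"
proof -
  have "(\<lambda>x. h x i) \<in> borel_measurable M" if "i < n" for i
    using assms that unfolding Rn_def
    by (auto intro: measurable_compose[OF _ measurable_component_singleton])
  then show ?thesis
    unfolding Rn_def point_scale_def by (intro measurable_restrict) auto
qed

text \<open>The l1 norm adds up the costs of shifting one coordinate at a time; measured in it, the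
  shift bound has a constant free of \<open>n\<close>.\<close>

definition point_norm :: "nat \<Rightarrow> point \<Rightarrow> real" where
  "point_norm n x = (\<Sum>i<n. \<bar>x i\<bar>)"

lemma measurable_point_norm [measurable]: "point_norm n \<in> borel_measurable (Rn n)"
proof -
  have "(\<lambda>x. x i) \<in> borel_measurable (Rn n)" if "i < n" for i
    using that unfolding Rn_def by (intro measurable_component_singleton) auto
  then show ?thesis unfolding point_norm_def[abs_def] by (intro borel_measurable_sum) auto
qed

lemma space_Rn_add [simp, intro]: "point_add n x y \<in> space (Rn n)"
  by (simp add: Rn_def space_PiM point_add_def)

lemma space_Rn_scale [simp, intro]: "point_scale n c x \<in> space (Rn n)"
  by (simp add: Rn_def space_PiM point_scale_def)

lemma point_add_commute: "point_add n x y = point_add n y x"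
  by (auto simp: point_add_def add.commute)

lemma point_add_assoc: "point_add n (point_add n x y) z = point_add n x (point_add n y z)"
  by (auto simp: point_add_def restrict_def)

lemma point_scale_add: "point_scale n c (point_add n x y) = point_add n (point_scale n c x) (point_scale n c y)"
  by (auto simp: point_add_def point_scale_def restrict_def algebra_simps)

lemma point_scale_add_left: "point_scale n (a + b) x = point_add n (point_scale n a x) (point_scale n b x)"
  by (auto simp: point_add_def point_scale_def restrict_def algebra_simps)

lemma point_scale_scale: "point_scale n a (point_scale n b x) = point_scale n (a * b) x"
  by (auto simp: point_scale_def restrict_def)

lemma point_scale_1: "x \<in> space (Rn n) \<Longrightarrow> point_scale n 1 x = x"
  by (auto simp: point_scale_def restrict_def Rn_def space_PiM fun_eq_iff PiE_def extensional_def)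

lemma point_norm_scale: "point_norm n (point_scale n c x) = \<bar>c\<bar> * point_norm n x"
  by (simp add: point_norm_def point_scale_def abs_mult sum_distrib_left)

lemma point_norm_nonneg: "point_norm n x \<ge> 0"
  by (simp add: point_norm_def sum_nonneg)

text \<open>Induction on the dimension: Fubini splits off the last coordinate, the induction
  hypothesis shifts the others with that coordinate fixed, and \<open>std_normal_shift\<close>
  shifts the last one in the inner integral, which is again bounded by 1. The errors add up to the
  l1 norm.\<close>

lemma std_gaussian_shift:
  fixes h :: "point \<Rightarrow> ennreal"
  assumes "h \<in> borel_measurable (Rn n)" and "\<And>x. h x \<le> 1"
  shows "(\<integral>\<^sup>+x. h (point_add n x q) \<partial>std_gaussian n)
       \<le> (\<integral>\<^sup>+x. h x \<partial>std_gaussian n) + ennreal (2 * point_norm n q)"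
  using assms
proof (induction n arbitrary: h)
  case 0
  have "point_add 0 x q = x" if "x \<in> space (std_gaussian 0)" for x
    using that by (auto simp: std_gaussian_def space_PiM point_add_def)
  then have "(\<integral>\<^sup>+x. h (point_add 0 x q) \<partial>std_gaussian 0) = (\<integral>\<^sup>+x. h x \<partial>std_gaussian 0)"
    by (intro nn_integral_cong) simp
  then show ?case by simp
next
  case (Suc n)
  note [measurable] = Suc.prems(1)
  interpret N: prob_space std_normal_distribution by (rule prob_space_normal_density) simp
  interpret P: product_sigma_finite "\<lambda>_::nat. std_normal_distribution" by standard
  interpret G: prob_space "std_gaussian n" by (rule prob_space_std_gaussian)
  interpret NG: pair_sigma_finite std_normal_distribution "std_gaussian n" by standard
  have unfold: "(\<integral>\<^sup>+x. u x \<partial>std_gaussian (Suc n))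
      = (\<integral>\<^sup>+y. (\<integral>\<^sup>+x. u (x(n := y)) \<partial>std_gaussian n) \<partial>std_normal_distribution)"
    if "u \<in> borel_measurable (Rn (Suc n))" for u :: "point \<Rightarrow> ennreal"
  proof -
    have "u \<in> borel_measurable (std_gaussian (Suc n))"
      using that by (simp cong: measurable_cong_sets add: sets_std_gaussian)
    then show ?thesis
      unfolding std_gaussian_def lessThan_Suc by (intro P.product_nn_integral_insert_rev) auto
  qed
  have upd [measurable]: "(\<lambda>(y, x). x(n := y)) \<in> borel \<Otimes>\<^sub>M Rn n \<rightarrow>\<^sub>M Rn (Suc n)"
  proof -
    have "(\<lambda>z. (snd z)(n := fst z)) \<in> borel \<Otimes>\<^sub>M Rn n \<rightarrow>\<^sub>M Rn (Suc n)"
      unfolding Rn_def lessThan_Suc by (intro measurable_fun_upd[where J = "{..<n}"]) auto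
    then show ?thesis by (simp add: case_prod_beta')
  qed
  have joint [measurable]: "(\<lambda>(y, x). h (x(n := y))) \<in> borel_measurable (borel \<Otimes>\<^sub>M Rn n)"
    using measurable_compose[OF upd Suc.prems(1)] by (simp add: case_prod_beta')
  have [measurable]: "(\<lambda>x. h (x(n := y))) \<in> borel_measurable (Rn n)" for y
    using measurable_Pair2[OF joint, of y] by simp
  have eq: "point_add (Suc n) (x(n := y)) q = (point_add n x q)(n := y + q n)" for x y
    by (auto simp: point_add_def restrict_def less_Suc_eq)
  have shifted: "(\<lambda>x. h (point_add (Suc n) x q)) \<in> borel_measurable (Rn (Suc n))"
  proof -
    \<comment> \<open>\<open>q\<close> need not lie in the space of \<open>Rn (Suc n)\<close>.
      Scaling it by 1 cuts it down to the relevant indices without changing the sum, so that the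
      measurability rule for \<open>point_add\<close> applies.\<close>
    have "point_add (Suc n) x q = point_add (Suc n) x (point_scale (Suc n) 1 q)" for x
      by (auto simp: point_add_def point_scale_def)
    then show ?thesis by simp
  qed
  have "(\<integral>\<^sup>+x. h (point_add (Suc n) x q) \<partial>std_gaussian (Suc n))
      = (\<integral>\<^sup>+y. (\<integral>\<^sup>+x. h ((point_add n x q)(n := y + q n)) \<partial>std_gaussian n) \<partial>std_normal_distribution)"
    by (simp add: unfold[OF shifted] eq)
  also have "\<dots> \<le> (\<integral>\<^sup>+y. ((\<integral>\<^sup>+x. h (x(n := y + q n)) \<partial>std_gaussian n)
      + ennreal (2 * point_norm n q)) \<partial>std_normal_distribution)"
    by (intro nn_integral_mono Suc.IH[of "\<lambda>x. h (x(n := _))"] Suc.prems(2)) measurable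
  also have "\<dots> = (\<integral>\<^sup>+y. (\<integral>\<^sup>+x. h (x(n := y + q n)) \<partial>std_gaussian n) \<partial>std_normal_distribution)
      + ennreal (2 * point_norm n q)"
    using N.emeasure_space_1 by (subst nn_integral_add) auto
  also have "(\<integral>\<^sup>+y. (\<integral>\<^sup>+x. h (x(n := y + q n)) \<partial>std_gaussian n) \<partial>std_normal_distribution)
      \<le> (\<integral>\<^sup>+y. (\<integral>\<^sup>+x. h (x(n := y)) \<partial>std_gaussian n) \<partial>std_normal_distribution) + ennreal (2 * \<bar>q n\<bar>)"
  proof (intro std_normal_shift)
    fix y
    have "(\<integral>\<^sup>+x. h (x(n := y)) \<partial>std_gaussian n) \<le> (\<integral>\<^sup>+x. 1 \<partial>std_gaussian n)"
      by (intro nn_integral_mono Suc.prems(2))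
    then show "(\<integral>\<^sup>+x. h (x(n := y)) \<partial>std_gaussian n) \<le> 1"
      using G.emeasure_space_1 by simp
  qed measurable
  finally show ?case
    by (simp add: unfold[OF Suc.prems(1)] point_norm_def sum_nonneg fun_upd_def algebra_simps)
qed

lemma measurable_of_bool [measurable (raw)]:
  assumes [measurable]: "Measurable.pred M P"
  shows "(\<lambda>x. of_bool (P x) :: ennreal) \<in> borel_measurable M"
  unfolding of_bool_def by measurable

subsection \<open>Self-correction\<close>

text \<open>A natural number, because additivity alone yields f p = k f (p / k) for natural k. The
  final \<open>+ 1\<close> keeps it nonzero when the norm vanishes.\<close>

definition scaling :: "nat \<Rightarrow> point \<Rightarrow> nat" where
  "scaling n p = nat \<lceil>100 * point_norm n p\<rceil> + 1"

lemma scaling_pos [simp]: "scaling n p > 0" "scaling n p \<noteq> 0"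
  by (simp_all add: scaling_def)

lemma measurable_scaling [measurable]: "(\<lambda>p. real (scaling n p)) \<in> borel_measurable (Rn n)"
  unfolding scaling_def by measurable

definition shrink :: "nat \<Rightarrow> point \<Rightarrow> point" where
  "shrink n p = point_scale n (1 / real (scaling n p)) p"

lemma measurable_shrink [measurable]: "shrink n \<in> Rn n \<rightarrow>\<^sub>M Rn n"
  unfolding shrink_def[abs_def] by measurable

lemma space_shrink [simp, intro]: "shrink n p \<in> space (Rn n)"
  by (simp add: shrink_def)

text \<open>With radius 1/100, shifting a Gaussian sample by a shrunken point costs at most 2/100 in
  probability, which the constants of the majority arguments can absorb.\<close>

lemma point_norm_shrink: "point_norm n (shrink n p) \<le> 1 / 100"
proof -
  have "100 * point_norm n p \<le> real (scaling n p)"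
    unfolding scaling_def using point_norm_nonneg[of n p] by linarith
  then show ?thesis
    by (simp add: shrink_def point_norm_scale field_simps)
qed

section \<open>Majority increments and the additive function built from them\<close>

context
  fixes n :: nat and f :: "point \<Rightarrow> real"
  assumes f [measurable]: "f \<in> borel_measurable (Rn n)"
begin

interpretation G: prob_space "std_gaussian n" by (rule prob_space_std_gaussian)

interpretation GG: pair_sigma_finite "std_gaussian n" "std_gaussian n" by standard

definition deviation :: "point \<Rightarrow> real \<Rightarrow> ennreal" where
  "deviation q v = (\<integral>\<^sup>+x. of_bool (f (point_add n x q) - f x \<noteq> v) \<partial>std_gaussian n)"

text \<open>The majority value \<phi>. The choice is meaningful only where a value of deviation at
  most 1/4 exists, as shown below for small \<open>q\<close>; elsewhere it is arbitrary.\<close>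

definition local_part :: "point \<Rightarrow> real" where
  "local_part q = (SOME v. deviation q v \<le> ennreal (1 / 4))"

definition corrected :: "point \<Rightarrow> real" where
  "corrected p = real (scaling n p) * local_part (shrink n p)"

definition additivity_defect :: ennreal where
  "additivity_defect =
     (\<integral>\<^sup>+y. (\<integral>\<^sup>+x. of_bool (f x + f y \<noteq> f (point_add n x y)) \<partial>std_gaussian n) \<partial>std_gaussian n)"

context
  assumes defect: "additivity_defect \<le> ennreal (1 / 10)"
begin

text \<open>A collision argument: two independent Gaussians see the same increment except with
  probability 24/100, since each of two shifted additivity checks fails with probability at most
  1/10 + 2/100. Averaging over one of them yields a value that the other misses with probability at
  most 1/4.\<close>

lemma ex_majority_value:
  assumes q [measurable]: "q \<in> space (Rn n)" and small: "point_norm n q \<le> 1 / 100"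
  shows "\<exists>v. deviation q v \<le> ennreal (1 / 4)"
proof -
  define B where "B = (\<lambda>x y. f (point_add n x q) + f y \<noteq> f (point_add n (point_add n x q) y))"
  define I where "I = (\<integral>\<^sup>+y. (\<integral>\<^sup>+x. of_bool (B x y) \<partial>std_gaussian n) \<partial>std_gaussian n)"
  define C where "C = (\<integral>\<^sup>+x. (\<integral>\<^sup>+y. of_bool (f (point_add n y q) - f y
      \<noteq> f (point_add n x q) - f x) \<partial>std_gaussian n) \<partial>std_gaussian n)"
  have B1: "(\<lambda>(x, y). of_bool (B x y) :: ennreal) \<in> borel_measurable (std_gaussian n \<Otimes>\<^sub>M std_gaussian n)"
    and B2: "(\<lambda>(x, y). of_bool (B y x) :: ennreal) \<in> borel_measurable (std_gaussian n \<Otimes>\<^sub>M std_gaussian n)"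
    unfolding B_def by measurable
  have "I \<le> (\<integral>\<^sup>+y. ((\<integral>\<^sup>+x. of_bool (f x + f y \<noteq> f (point_add n x y)) \<partial>std_gaussian n)
      + ennreal (2 * point_norm n q)) \<partial>std_gaussian n)"
    unfolding I_def
  proof (rule nn_integral_mono)
    fix y assume "y \<in> space (std_gaussian n)"
    then have [measurable]: "y \<in> space (Rn n)"
      using sets_eq_imp_space_eq[OF sets_std_gaussian] by blast
    show "(\<integral>\<^sup>+x. of_bool (B x y) \<partial>std_gaussian n)
      \<le> (\<integral>\<^sup>+x. of_bool (f x + f y \<noteq> f (point_add n x y)) \<partial>std_gaussian n) + ennreal (2 * point_norm n q)"
      unfolding B_def
    proof (rule std_gaussian_shift[where h = "\<lambda>z. of_bool (f z + f y \<noteq> f (point_add n z y))"])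
      have 1: "(\<lambda>z. f (point_add n z y)) \<in> borel_measurable (Rn n)"
        by measurable
      have 2: "(\<lambda>z. f z + f y) \<in> borel_measurable (Rn n)"
        by measurable
      have [measurable]: "Measurable.pred (Rn n) (\<lambda>z. f z + f y = f (point_add n z y))"
        unfolding pred_def by (rule borel_measurable_eq[OF 2 1])
      show "(\<lambda>z. of_bool (f z + f y \<noteq> f (point_add n z y)) :: ennreal) \<in> borel_measurable (Rn n)"
        by measurable
    qed (simp add: of_bool_def)
  qed
  also have "\<dots> = additivity_defect + ennreal (2 * point_norm n q)"
    unfolding additivity_defect_def using G.emeasure_space_1 by (subst nn_integral_add) auto
  also have "\<dots> \<le> ennreal (1 / 10) + ennreal (2 / 100)"
    using small by (intro add_mono defect ennreal_leI) auto
  finally have I: "I \<le> ennreal (12 / 100)"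
    by (simp flip: ennreal_plus)
  have "C \<le> (\<integral>\<^sup>+x. (\<integral>\<^sup>+y. of_bool (B x y) + of_bool (B y x) \<partial>std_gaussian n) \<partial>std_gaussian n)"
    unfolding C_def
  proof (intro nn_integral_mono)
    fix x y
    \<comment> \<open>Both checks end in the same point x + q + y, so if both hold, subtracting them
      equates the increments at \<open>x\<close> and \<open>y\<close>.\<close>
    have "point_add n (point_add n x q) y = point_add n (point_add n y q) x"
      by (auto simp: point_add_def restrict_def)
    then show "of_bool (f (point_add n y q) - f y \<noteq> f (point_add n x q) - f x)
        \<le> (of_bool (B x y) + of_bool (B y x) :: ennreal)"
      unfolding B_def by (auto simp: of_bool_def)
  qed
  also have "\<dots> = (\<integral>\<^sup>+x. (\<integral>\<^sup>+y. of_bool (B x y) \<partial>std_gaussian n) \<partial>std_gaussian n)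
      + (\<integral>\<^sup>+x. (\<integral>\<^sup>+y. of_bool (B y x) \<partial>std_gaussian n) \<partial>std_gaussian n)"
  proof -
    have pair: "(\<lambda>y. of_bool (B x y) :: ennreal) \<in> borel_measurable (std_gaussian n)"
      "(\<lambda>y. of_bool (B y x) :: ennreal) \<in> borel_measurable (std_gaussian n)"
      if "x \<in> space (std_gaussian n)" for x
      using measurable_Pair2[OF B1 that] measurable_Pair2[OF B2 that] by simp_all
    have "(\<integral>\<^sup>+x. (\<integral>\<^sup>+y. of_bool (B x y) + of_bool (B y x) \<partial>std_gaussian n) \<partial>std_gaussian n)
      = (\<integral>\<^sup>+x. (\<integral>\<^sup>+y. of_bool (B x y) \<partial>std_gaussian n) + (\<integral>\<^sup>+y. of_bool (B y x) \<partial>std_gaussian n)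
          \<partial>std_gaussian n)"
      by (intro nn_integral_cong nn_integral_add pair)
    also have "\<dots> = (\<integral>\<^sup>+x. (\<integral>\<^sup>+y. of_bool (B x y) \<partial>std_gaussian n) \<partial>std_gaussian n)
      + (\<integral>\<^sup>+x. (\<integral>\<^sup>+y. of_bool (B y x) \<partial>std_gaussian n) \<partial>std_gaussian n)"
      by (intro nn_integral_add G.borel_measurable_nn_integral B1 B2)
    finally show ?thesis .
  qed
  also have "(\<integral>\<^sup>+x. (\<integral>\<^sup>+y. of_bool (B x y) \<partial>std_gaussian n) \<partial>std_gaussian n) = I"
    unfolding I_def by (rule GG.Fubini'[symmetric, OF B1])
  \<comment> \<open>This integral is \<open>I\<close> with its bound variables renamed; only the
    previous one needed Fubini.\<close>
  also have "(\<integral>\<^sup>+x. (\<integral>\<^sup>+y. of_bool (B y x) \<partial>std_gaussian n) \<partial>std_gaussian n) = I"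
    unfolding I_def ..
  also have "I + I \<le> ennreal (12 / 100) + ennreal (12 / 100)"
    by (intro add_mono I)
  finally have C: "C \<le> ennreal (24 / 100)"
    by (simp flip: ennreal_plus)
  show ?thesis
  proof (rule ccontr)
    assume "\<not> ?thesis"
    \<comment> \<open>For each \<open>x\<close> the negated claim is applied to the increment at
      \<open>x\<close> itself, which bounds every inner integral of \<open>C\<close> below by
      1/4.\<close>
    then have "C \<ge> (\<integral>\<^sup>+x. ennreal (1 / 4) \<partial>std_gaussian n)"
      unfolding C_def deviation_def by (intro nn_integral_mono) (auto simp: not_le intro: less_imp_le)
    then have "ennreal (1 / 4) \<le> ennreal (24 / 100)"
      using order_trans[OF _ C, of "ennreal (1 / 4)"] G.emeasure_space_1 by simp
    then show False by (subst (asm) ennreal_le_iff) auto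
  qed
qed

lemma deviation_local_part:
  assumes "q \<in> space (Rn n)" "point_norm n q \<le> 1 / 100"
  shows "deviation q (local_part q) \<le> ennreal (1 / 4)"
  unfolding local_part_def using ex_majority_value[OF assms] by (rule someI_ex)

text \<open>The increment by a + b at x telescopes into the increment by \<open>a\<close> at x and
  the increment by \<open>b\<close> at x + a. The three majority values are missed with total
  probability at most 3/4 + 2/100 < 1, the 2/100 paying for the base point x + a, so some x realises
  all three at once.\<close>

lemma local_part_add:
  assumes [measurable]: "a \<in> space (Rn n)" "b \<in> space (Rn n)"
    and small: "point_norm n a \<le> 1 / 100" "point_norm n b \<le> 1 / 100"
      "point_norm n (point_add n a b) \<le> 1 / 100"
  shows "local_part (point_add n a b) = local_part a + local_part b"
proof (rule ccontr)
  let ?c = "point_add n a b"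
  define h where "h = (\<lambda>x. of_bool (f (point_add n x b) - f x \<noteq> local_part b) :: ennreal)"
  have [measurable]: "h \<in> borel_measurable (Rn n)" unfolding h_def by measurable
  assume ne: "local_part ?c \<noteq> local_part a + local_part b"
  have "1 = (\<integral>\<^sup>+x. 1 \<partial>std_gaussian n)"
    using G.emeasure_space_1 by simp
  also have "\<dots> \<le> (\<integral>\<^sup>+x. of_bool (f (point_add n x a) - f x \<noteq> local_part a)
      + h (point_add n x a)
      + of_bool (f (point_add n x ?c) - f x \<noteq> local_part ?c) \<partial>std_gaussian n)"
    using ne by (intro nn_integral_mono) (auto simp: of_bool_def h_def point_add_assoc)
  also have "\<dots> = deviation a (local_part a) + (\<integral>\<^sup>+x. h (point_add n x a) \<partial>std_gaussian n)
      + deviation ?c (local_part ?c)"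
    unfolding deviation_def by (simp add: nn_integral_add)
  also have "\<dots> \<le> ennreal (1 / 4) + (ennreal (1 / 4) + ennreal (2 / 100)) + ennreal (1 / 4)"
  proof -
    have "(\<integral>\<^sup>+x. h (point_add n x a) \<partial>std_gaussian n)
      \<le> deviation b (local_part b) + ennreal (2 * point_norm n a)"
      unfolding deviation_def h_def[symmetric]
      by (rule std_gaussian_shift) (measurable, simp add: h_def of_bool_def)
    also have "\<dots> \<le> ennreal (1 / 4) + ennreal (2 / 100)"
      using small assms(2) by (intro add_mono deviation_local_part ennreal_leI) auto
    finally show ?thesis
      using small assms(1) by (intro add_mono deviation_local_part) auto
  qed
  also have "\<dots> = ennreal (77 / 100)"
    by (simp flip: ennreal_plus)
  also have "\<dots> < 1"
    by (simp add: ennreal_less_one_iff)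
  finally show False by simp
qed

text \<open>Induction along the points (i / j) q for i up to j: all of them are no longer than
  \<open>q\<close>, so local additivity applies at each step.\<close>

lemma local_part_multiple:
  assumes q: "q \<in> space (Rn n)" and small: "point_norm n q \<le> 1 / 100" and j: "j > 0"
  shows "local_part q = real j * local_part (point_scale n (1 / real j) q)"
proof -
  have small': "point_norm n (point_scale n (real i / real j) q) \<le> 1 / 100" if "i \<le> j" for i
  proof -
    have "real i / real j * point_norm n q \<le> 1 * point_norm n q"
      using that j by (intro mult_right_mono point_norm_nonneg) (simp add: field_simps)
    also have "\<dots> \<le> 1 / 100" using small by simp
    finally have "\<bar>real i / real j\<bar> * point_norm n q \<le> 1 / 100" by simp
    then show ?thesis unfolding point_norm_scale .
  qed
  have "local_part (point_scale n (real i / real j) q) = real i * local_part (point_scale n (1 / real j) q)"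
    if "i \<le> j" for i
    using that
  proof (induction i)
    case 0
    have "point_add n (point_scale n 0 q) (point_scale n 0 q) = point_scale n 0 q"
      by (simp flip: point_scale_add_left)
    then show ?case
      using local_part_add[of "point_scale n 0 q" "point_scale n 0 q"] small'[of 0] by simp
  next
    case (Suc i)
    have eq: "point_scale n (real (Suc i) / real j) q
        = point_add n (point_scale n (real i / real j) q) (point_scale n (1 / real j) q)"
      by (simp add: add_divide_distrib add.commute flip: point_scale_add_left)
    have "local_part (point_scale n (real (Suc i) / real j) q)
        = local_part (point_scale n (real i / real j) q) + local_part (point_scale n (1 / real j) q)"
      unfolding eq using small'[OF Suc.prems] small'[of i] small'[of 1] Suc.prems j
      by (intro local_part_add) (auto simp flip: eq)
    with Suc show ?case by (simp add: algebra_simps)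
  qed
  from this[of j] show ?thesis using j q by (simp add: point_scale_1)
qed

text \<open>The scaling factor may be replaced by any positive multiple of itself, so several points
  can be brought to one common scale.\<close>

lemma corrected_eq:
  assumes "j > 0"
  shows "corrected p = real (scaling n p * j) * local_part (point_scale n (1 / real (scaling n p * j)) p)"
proof -
  have "local_part (shrink n p) = real j * local_part (point_scale n (1 / real j) (shrink n p))"
    by (intro local_part_multiple assms point_norm_shrink) auto
  then show ?thesis
    by (simp add: corrected_def shrink_def point_scale_scale mult.commute)
qed

lemma additive_corrected: "additive_fun n corrected"
  unfolding additive_fun_def
proof (intro ballI)
  fix x y assume xy: "x \<in> space (Rn n)" "y \<in> space (Rn n)"
  define a b c where "a = scaling n x" "b = scaling n y" "c = scaling n (point_add n x y)"
  \<comment> \<open>A common multiple of the three scalings: at scale \<open>K\<close> all three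
    points are small, and additivity reduces to one use of \<open>local_part_add\<close>.\<close>
  define K where "K = a * b * c"
  have pos: "a > 0" "b > 0" "c > 0" by (simp_all add: a_b_c_def)
  have K: "K = a * (b * c)" "K = b * (a * c)" "K = c * (a * b)" by (simp_all add: K_def)
  have small: "point_norm n (point_scale n (1 / real K) z) \<le> 1 / 100"
    if "K = scaling n z * j" "j > 0" for z j
  proof -
    have eq: "point_scale n (1 / real K) z = point_scale n (1 / real j) (shrink n z)"
      using that by (simp add: shrink_def point_scale_scale mult.commute)
    have "\<bar>1 / real j\<bar> * point_norm n (shrink n z) \<le> 1 * point_norm n (shrink n z)"
      using that by (intro mult_right_mono point_norm_nonneg) simp
    also have "\<dots> \<le> 1 / 100" using point_norm_shrink[of n z] by simp
    finally show ?thesis unfolding eq point_norm_scale .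
  qed
  have "corrected (point_add n x y) = real K * local_part (point_scale n (1 / real K) (point_add n x y))"
    using corrected_eq[of "a * b" "point_add n x y"] pos K by (simp add: a_b_c_def)
  also have "\<dots> = real K * (local_part (point_scale n (1 / real K) x) + local_part (point_scale n (1 / real K) y))"
  proof -
    have "point_norm n (point_scale n (1 / real K) x) \<le> 1 / 100"
      "point_norm n (point_scale n (1 / real K) y) \<le> 1 / 100"
      "point_norm n (point_scale n (1 / real K) (point_add n x y)) \<le> 1 / 100"
      using small[OF K(1)[unfolded a_b_c_def]] small[OF K(2)[unfolded a_b_c_def]]
        small[OF K(3)[unfolded a_b_c_def]] by simp_all
    then show ?thesis
      unfolding point_scale_add by (subst local_part_add) auto
  qed
  also have "\<dots> = corrected x + corrected y"
    using corrected_eq[of "b * c" x] corrected_eq[of "a * c" y] pos K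
    by (simp add: a_b_c_def algebra_simps)
  finally show "corrected (point_add n x y) = corrected x + corrected y" .
qed

lemma deviation_corrected:
  "(\<integral>\<^sup>+x. of_bool (real (scaling n p) * (f (point_add n x (shrink n p)) - f x) \<noteq> corrected p) \<partial>std_gaussian n)
     \<le> ennreal (1 / 4)"
  using deviation_local_part[OF space_shrink[of n p] point_norm_shrink]
  by (simp add: deviation_def corrected_def)

text \<open>The choice operator says nothing about measurability. But \<open>corrected p\<close> is
  the value of \<open>F p x\<close> for at least 3/4 of the Gaussian mass, so its sublevel sets can
  be read off from the measurable probability \<open>u p\<close> that
  \<open>F p x \<le> c\<close>.\<close>

lemma measurable_corrected [measurable]: "corrected \<in> borel_measurable (Rn n)"
  unfolding borel_measurable_iff_le
proof
  fix c
  define F where "F = (\<lambda>p x. real (scaling n p) * (f (point_add n x (shrink n p)) - f x))"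
  have [measurable]: "(\<lambda>(p, x). F p x) \<in> borel_measurable (Rn n \<Otimes>\<^sub>M Rn n)"
    unfolding F_def by measurable
  define u where "u = (\<lambda>p. \<integral>\<^sup>+x. of_bool (F p x \<le> c) \<partial>std_gaussian n)"
  have [measurable]: "u \<in> borel_measurable (Rn n)" unfolding u_def by measurable
  \<comment> \<open>That probability is at least 3/4 or at most 1/4; 3/5 is a threshold strictly
    between the two.\<close>
  have "corrected p \<le> c \<longleftrightarrow> ennreal (3 / 5) \<le> u p" if [measurable]: "p \<in> space (Rn n)" for p
  proof
    have [measurable]: "F p \<in> borel_measurable (Rn n)" unfolding F_def by measurable
    {
      assume "corrected p \<le> c"
      have "1 = (\<integral>\<^sup>+x. 1 \<partial>std_gaussian n)"
        using G.emeasure_space_1 by simp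
      also have "\<dots> \<le> (\<integral>\<^sup>+x. of_bool (F p x \<noteq> corrected p) + of_bool (F p x \<le> c) \<partial>std_gaussian n)"
        using \<open>corrected p \<le> c\<close> by (intro nn_integral_mono) (auto simp: of_bool_def)
      also have "\<dots> \<le> ennreal (1 / 4) + u p"
        using deviation_corrected[of p] unfolding u_def
        by (subst nn_integral_add) (auto simp: F_def intro!: add_right_mono)
      finally have *: "1 \<le> ennreal (1 / 4) + u p" .
      show "ennreal (3 / 5) \<le> u p"
      proof (rule ccontr)
        assume "\<not> ennreal (3 / 5) \<le> u p"
        then have "ennreal (1 / 4) + u p \<le> ennreal (1 / 4) + ennreal (3 / 5)"
          by (intro add_left_mono) simp
        also have "\<dots> = ennreal (17 / 20)" by (simp flip: ennreal_plus)
        also have "\<dots> < 1" by (simp add: ennreal_less_one_iff)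
        finally show False using * by simp
      qed
    }
    assume *: "ennreal (3 / 5) \<le> u p"
    show "corrected p \<le> c"
    proof (rule ccontr)
      assume "\<not> corrected p \<le> c"
      then have "u p \<le> (\<integral>\<^sup>+x. of_bool (F p x \<noteq> corrected p) \<partial>std_gaussian n)"
        unfolding u_def by (intro nn_integral_mono) (auto simp: of_bool_def)
      also have "\<dots> \<le> ennreal (1 / 4)"
        using deviation_corrected[of p] by (simp add: F_def)
      finally have "u p \<le> ennreal (1 / 4)" .
      with * have "ennreal (3 / 5) \<le> ennreal (1 / 4)" by (rule order_trans)
      then show False by (subst (asm) ennreal_le_iff) auto
    qed
  qed
  then have "{p \<in> space (Rn n). corrected p \<le> c} = {p \<in> space (Rn n). ennreal (3 / 5) \<le> u p}"
    by auto
  then show "{p \<in> space (Rn n). corrected p \<le> c} \<in> sets (Rn n)" by simp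
qed

text \<open>The check compares \<open>f p\<close> with a quantity equal to
  \<open>corrected p\<close> for at least 3/4 of the Gaussian mass, and it fails whenever that
  equality holds.\<close>

lemma disagreement_detected:
  assumes [measurable]: "p \<in> space (Rn n)" and "f p \<noteq> corrected p"
  shows "ennreal (3 / 4)
    \<le> (\<integral>\<^sup>+x. of_bool (f p \<noteq> real (scaling n p) * (f (point_add n x (shrink n p)) - f x)) \<partial>std_gaussian n)"
    (is "_ \<le> ?R")
proof -
  define F where "F = (\<lambda>x. real (scaling n p) * (f (point_add n x (shrink n p)) - f x))"
  have [measurable]: "F \<in> borel_measurable (Rn n)" unfolding F_def by measurable
  have "1 = (\<integral>\<^sup>+x. 1 \<partial>std_gaussian n)"
    using G.emeasure_space_1 by simp
  also have "\<dots> \<le> (\<integral>\<^sup>+x. of_bool (F x \<noteq> corrected p) + of_bool (f p \<noteq> F x) \<partial>std_gaussian n)"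
    using assms(2) by (intro nn_integral_mono) (auto simp: of_bool_def)
  also have "\<dots> \<le> ennreal (1 / 4) + ?R"
    using deviation_corrected[of p]
    by (subst nn_integral_add) (auto simp: F_def intro!: add_right_mono)
  finally have *: "1 \<le> ennreal (1 / 4) + ?R" .
  have "ennreal (1 / 4) + ennreal (3 / 4) = 1" by (simp flip: ennreal_plus)
  with * have "ennreal (1 / 4) + ennreal (3 / 4) \<le> ennreal (1 / 4) + ?R" by simp
  then show ?thesis by (simp only: ennreal_add_left_cancel_le) auto
qed

end

end

subsection \<open>The tester\<close>

definition passes :: "nat \<Rightarrow> (point \<Rightarrow> real) \<Rightarrow> point \<Rightarrow> point \<Rightarrow> point \<Rightarrow> bool" where
  "passes n f x y p \<longleftrightarrow> f x + f y = f (point_add n x y)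
     \<and> f p = real (scaling n p) * (f (point_add n x (shrink n p)) - f x)"

text \<open>The continuation \<open>T\<close> makes rounds iterable by \<open>^^\<close>. Sharing
  \<open>x\<close> between the two checks is harmless: rejection will be bounded below by either
  check alone, never by a product.\<close>

definition test_round :: "nat \<Rightarrow> algorithm \<Rightarrow> algorithm" where
  "test_round n T =
     Gaussian (\<lambda>x. Gaussian (\<lambda>y. Sample (\<lambda>p.
       Query x (\<lambda>fx. Query y (\<lambda>fy. Query (point_add n x y) (\<lambda>fxy.
       Query p (\<lambda>fp. Query (point_add n x (shrink n p)) (\<lambda>fxp.
         if fx + fy = fxy \<and> fp = real (scaling n p) * (fxp - fx) then T else Reject))))))))"

text \<open>The verdict after all three draws, with the continuation abstracted to its law
  \<open>V\<close>. Measurability can then be settled without inspecting the algorithm that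
  follows.\<close>

definition round_kernel ::
    "nat \<Rightarrow> (point \<Rightarrow> real) \<Rightarrow> bool measure \<Rightarrow> point \<Rightarrow> point \<Rightarrow> point \<Rightarrow> bool measure" where
  "round_kernel n f V x y p = (if passes n f x y p then V else return (count_space UNIV) False)"

lemma verdict_test_round:
  "verdict n f D (test_round n T) = std_gaussian n \<bind> (\<lambda>x. std_gaussian n \<bind> (\<lambda>y.
     D \<bind> round_kernel n f (verdict n f D T) x y))"
  unfolding test_round_def round_kernel_def[abs_def] passes_def
  by (simp add: if_distrib[of "verdict n f D"] cong: if_cong)

section \<open>Measurability and law of one round\<close>

context
  fixes n :: nat and f :: "point \<Rightarrow> real" and D :: "point measure" and V :: "bool measure"
  assumes f [measurable]: "f \<in> borel_measurable (Rn n)"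
    and D [measurable]: "D \<in> space (prob_algebra (Rn n))"
    and V [measurable]: "V \<in> space (prob_algebra (count_space UNIV))"
begin

text \<open>Joint measurability in the three draws is the root fact: the conditions that
  \<open>well_formed\<close> puts on the nested draws follow by alternately taking sections and
  integrating out the innermost draw.\<close>

lemma measurable_round_kernel:
  "(\<lambda>(z, p). round_kernel n f V (fst z) (snd z) p)
     \<in> (Rn n \<Otimes>\<^sub>M Rn n) \<Otimes>\<^sub>M Rn n \<rightarrow>\<^sub>M prob_algebra (count_space UNIV)"
proof -
  have [measurable]: "return (count_space UNIV) False \<in> space (prob_algebra (count_space UNIV))"
    by (simp add: space_prob_algebra prob_space_return)
  show ?thesis
    unfolding round_kernel_def passes_def by measurable
qed

lemma measurable_round_kernel_sample:
  assumes "x \<in> space (Rn n)" "y \<in> space (Rn n)"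
  shows "round_kernel n f V x y \<in> Rn n \<rightarrow>\<^sub>M prob_algebra (count_space UNIV)"
  using measurable_Pair2[OF measurable_round_kernel, of "(x, y)"] assms by (simp add: space_pair_measure)

lemma measurable_bind_round_kernel:
  "(\<lambda>(x, y). D \<bind> round_kernel n f V x y) \<in> Rn n \<Otimes>\<^sub>M Rn n \<rightarrow>\<^sub>M prob_algebra (count_space UNIV)"
proof -
  have "(\<lambda>z. D \<bind> round_kernel n f V (fst z) (snd z)) \<in> Rn n \<Otimes>\<^sub>M Rn n \<rightarrow>\<^sub>M prob_algebra (count_space UNIV)"
    by (rule measurable_bind_prob_space2[OF measurable_const[OF D] measurable_round_kernel])
  then show ?thesis by (simp add: split_beta')
qed

lemma measurable_bind_round_kernel_gaussian:
  assumes "x \<in> space (Rn n)"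
  shows "(\<lambda>y. D \<bind> round_kernel n f V x y) \<in> Rn n \<rightarrow>\<^sub>M prob_algebra (count_space UNIV)"
  using measurable_Pair2[OF measurable_bind_round_kernel assms] by simp

lemma measurable_bind_bind_round_kernel:
  "(\<lambda>x. std_gaussian n \<bind> (\<lambda>y. D \<bind> round_kernel n f V x y))
     \<in> Rn n \<rightarrow>\<^sub>M prob_algebra (count_space UNIV)"
  by (rule measurable_bind_prob_space2[OF measurable_const[OF std_gaussian_in_prob_algebra]
        measurable_bind_round_kernel])

lemma emeasure_bind_round_kernel:
  "emeasure (std_gaussian n \<bind> (\<lambda>x. std_gaussian n \<bind> (\<lambda>y. D \<bind> round_kernel n f V x y))) {b}
     = (\<integral>\<^sup>+x. \<integral>\<^sup>+y. \<integral>\<^sup>+p. emeasure (round_kernel n f V x y p) {b} \<partial>D \<partial>std_gaussian n \<partial>std_gaussian n)"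
proof -
  have space: "space (std_gaussian n) = space (Rn n)"
    by (rule sets_eq_imp_space_eq[OF sets_std_gaussian])
  have "emeasure (std_gaussian n \<bind> (\<lambda>x. std_gaussian n \<bind> (\<lambda>y. D \<bind> round_kernel n f V x y))) {b}
      = (\<integral>\<^sup>+x. emeasure (std_gaussian n \<bind> (\<lambda>y. D \<bind> round_kernel n f V x y)) {b} \<partial>std_gaussian n)"
    by (rule emeasure_bind_prob_algebra[OF std_gaussian_in_prob_algebra measurable_bind_bind_round_kernel])
      simp
  also have "\<dots> = (\<integral>\<^sup>+x. \<integral>\<^sup>+y. emeasure (D \<bind> round_kernel n f V x y) {b} \<partial>std_gaussian n \<partial>std_gaussian n)"
    by (intro nn_integral_cong emeasure_bind_prob_algebra[OF std_gaussian_in_prob_algebra, where L = "count_space UNIV"]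
        measurable_bind_round_kernel_gaussian) (simp_all add: space)
  also have "\<dots> = (\<integral>\<^sup>+x. \<integral>\<^sup>+y. \<integral>\<^sup>+p. emeasure (round_kernel n f V x y p) {b} \<partial>D \<partial>std_gaussian n \<partial>std_gaussian n)"
    by (intro nn_integral_cong emeasure_bind_prob_algebra[OF D, where L = "count_space UNIV"]
        measurable_round_kernel_sample) (simp_all add: space)
  finally show ?thesis .
qed

end

section \<open>Well-formedness and query cost of rounds\<close>

lemma well_formed_test_round:
  assumes T: "well_formed n T"
  shows "well_formed n (test_round n T)"
proof -
  \<comment> \<open>Moving \<open>verdict\<close> inside the conditional produces the body of
    \<open>round_kernel\<close>, so the three measurability lemmas match once \<open>K\<close> is
    unfolded.\<close>
  have *: "verdict n f D (if b then T else Reject)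
      = (if b then verdict n f D T else return (count_space UNIV) False)" for f D b
    by simp
  note V = verdict_in_prob_algebra[OF _ _ T]
  note K = round_kernel_def[abs_def] passes_def
  show ?thesis
    unfolding test_round_def well_formed.simps verdict.simps *
    using T measurable_round_kernel_sample[OF _ _ V, unfolded K]
      measurable_bind_round_kernel_gaussian[OF _ _ V, unfolded K]
      measurable_bind_bind_round_kernel[OF _ _ V, unfolded K]
    by (auto simp: shrink_def)
qed

lemma well_formed_funpow: "well_formed n ((test_round n ^^ m) Accept)"
  by (induction m) (simp_all add: well_formed_test_round)

lemma query_complexity_Query_le:
  assumes "\<And>y. query_complexity (k y) \<le> c"
  shows "query_complexity (Query x k) \<le> eSuc c"
  using assms by (auto intro: SUP_least)

lemma query_complexity_test_round:
  "query_complexity (test_round n T) \<le> 5 + query_complexity T"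
proof -
  have "query_complexity (test_round n T) \<le> eSuc (eSuc (eSuc (eSuc (eSuc (query_complexity T)))))"
    unfolding test_round_def query_complexity.simps(4,5)
    by (intro SUP_least query_complexity_Query_le) simp
  also have "\<dots> = 5 + query_complexity T"
    by (simp add: eSuc_plus_1 flip: numeral_plus_one add.assoc)
  finally show ?thesis .
qed

section \<open>Acceptance and rejection probabilities\<close>

context
  fixes n :: nat and f :: "point \<Rightarrow> real" and D :: "point measure"
  assumes f [measurable]: "f \<in> borel_measurable (Rn n)"
    and D: "D \<in> space (prob_algebra (Rn n))"
begin

interpretation G: prob_space "std_gaussian n" by (rule prob_space_std_gaussian)

interpretation D: prob_space D using D by (simp add: space_prob_algebra)

interpretation GD: pair_sigma_finite "std_gaussian n" D by standard

lemma sets_D [measurable_cong]: "sets D = sets (Rn n)"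
  using D by (simp add: space_prob_algebra)

lemma space_D: "space D = space (Rn n)"
  by (rule sets_eq_imp_space_eq[OF sets_D])

lemma space_G: "space (std_gaussian n) = space (Rn n)"
  by (rule sets_eq_imp_space_eq[OF sets_std_gaussian])

definition rejection :: ennreal where
  "rejection = (\<integral>\<^sup>+x. \<integral>\<^sup>+y. \<integral>\<^sup>+p. of_bool (\<not> passes n f x y p) \<partial>D \<partial>std_gaussian n \<partial>std_gaussian n)"

text \<open>Only the first check is counted.\<close>

lemma rejection_ge_defect: "additivity_defect n f \<le> rejection"
proof -
  \<comment> \<open>The integral over \<open>D\<close> is that of a constant. The check is symmetric
    in \<open>x\<close> and \<open>y\<close>, so the order of the Gaussian integrals is a matter of
    renaming.\<close>
  have "additivity_defect n f = (\<integral>\<^sup>+x. \<integral>\<^sup>+y. \<integral>\<^sup>+p. of_bool (f x + f y \<noteq> f (point_add n x y))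
      \<partial>D \<partial>std_gaussian n \<partial>std_gaussian n)"
    using D.emeasure_space_1
    by (simp add: additivity_defect_def[OF f] point_add_commute[of n] add.commute)
  also have "\<dots> \<le> rejection"
    unfolding rejection_def by (intro nn_integral_mono) (simp add: passes_def of_bool_def)
  finally show ?thesis .
qed

text \<open>Only the second check is counted: \<open>disagreement_detected\<close> is averaged over
  \<open>p\<close>, and Fubini restores the order of the draws.\<close>

lemma rejection_ge_distance:
  assumes defect: "additivity_defect n f \<le> ennreal (1 / 10)"
  shows "ennreal (3 / 4) * emeasure D {p \<in> space D. f p \<noteq> corrected n f p} \<le> rejection"
proof -
  note [measurable] = measurable_corrected[OF f defect]
  define F where "F = (\<lambda>x p. of_bool (f p \<noteq> real (scaling n p) * (f (point_add n x (shrink n p)) - f x)) :: ennreal)"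
  have Fm: "case_prod F \<in> borel_measurable (std_gaussian n \<Otimes>\<^sub>M D)"
    unfolding F_def by measurable
  have "ennreal (3 / 4) * emeasure D {p \<in> space D. f p \<noteq> corrected n f p}
      = (\<integral>\<^sup>+p. ennreal (3 / 4) * indicator {p \<in> space D. f p \<noteq> corrected n f p} p \<partial>D)"
    using borel_measurable_neq[OF f measurable_corrected[OF f defect]]
    by (subst nn_integral_cmult_indicator) (auto simp: space_D sets_D)
  also have "\<dots> \<le> (\<integral>\<^sup>+p. \<integral>\<^sup>+x. F x p \<partial>std_gaussian n \<partial>D)"
    using disagreement_detected[OF f defect]
    by (intro nn_integral_mono) (auto simp: indicator_def F_def space_D)
  also have "\<dots> = (\<integral>\<^sup>+x. \<integral>\<^sup>+p. F x p \<partial>D \<partial>std_gaussian n)"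
    by (rule GD.Fubini'[OF Fm])
  also have "\<dots> = (\<integral>\<^sup>+x. \<integral>\<^sup>+y. \<integral>\<^sup>+p. F x p \<partial>D \<partial>std_gaussian n \<partial>std_gaussian n)"
    using G.emeasure_space_1 by simp
  also have "\<dots> \<le> rejection"
    unfolding rejection_def F_def by (intro nn_integral_mono) (simp add: passes_def of_bool_def)
  finally show ?thesis .
qed

text \<open>If the defect is small, \<open>corrected\<close> is an additive measurable competitor,
  so farness bounds its disagreement with \<open>f\<close> and the second check rejects. Otherwise
  the first check rejects with probability above 1/10.\<close>

lemma rejection_ge:
  assumes \<epsilon>: "\<epsilon> > 0" and far: "eps_far n (additive_fun n) D \<epsilon> f"
  shows "ennreal (\<epsilon> / 10) \<le> rejection"
proof (cases "additivity_defect n f \<le> ennreal (1 / 10)")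
  case True
  have "\<epsilon> < measure D {p \<in> space D. f p \<noteq> corrected n f p}"
    using far additive_corrected[OF f True] measurable_corrected[OF f True]
    by (simp add: eps_far_def)
  then have "ennreal (3 / 4 * \<epsilon>) \<le> ennreal (3 / 4) * emeasure D {p \<in> space D. f p \<noteq> corrected n f p}"
    using \<epsilon> by (simp add: D.emeasure_eq_measure ennreal_leI flip: ennreal_mult)
  moreover have "ennreal (\<epsilon> / 10) \<le> ennreal (3 / 4 * \<epsilon>)"
    using \<epsilon> by (intro ennreal_leI) simp
  ultimately show ?thesis
    using rejection_ge_distance[OF True] by (meson order_trans)
next
  case False
  \<comment> \<open>Being far from the zero function forces \<epsilon> < 1, so 1/10 is at least
    \<epsilon> / 10.\<close>
  have "additive_fun n (\<lambda>_. 0)" by (simp add: additive_fun_def)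
  then have "\<epsilon> < measure D {x \<in> space D. f x \<noteq> 0}"
    using far by (simp add: eps_far_def)
  also have "\<dots> \<le> 1" by simp
  finally have "ennreal (\<epsilon> / 10) \<le> ennreal (1 / 10)" by (intro ennreal_leI) simp
  also have "\<dots> \<le> rejection"
    using False rejection_ge_defect by simp
  finally show ?thesis .
qed

definition acceptance :: real where
  "acceptance = measure (verdict n f D (test_round n Accept)) {True}"

lemma prob_space_verdict:
  assumes "well_formed n T"
  shows "prob_space (verdict n f D T)" "sets (verdict n f D T) = UNIV"
  using verdict_in_prob_algebra[OF f D assms] by (simp_all add: space_prob_algebra)

lemma measure_verdict_False:
  assumes "well_formed n T"
  shows "measure (verdict n f D T) {False} = 1 - measure (verdict n f D T) {True}"
proof -
  interpret V: prob_space "verdict n f D T" by (rule prob_space_verdict[OF assms])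
  have "space (verdict n f D T) = UNIV"
    using prob_space_verdict(2)[OF assms] sets.sets_into_space[of UNIV "verdict n f D T"] by auto
  then have "{False} = space (verdict n f D T) - {True}" by auto
  then show ?thesis
    using V.prob_compl[of "{True}"] prob_space_verdict(2)[OF assms] by simp
qed

lemma emeasure_verdict_test_round:
  assumes "well_formed n T"
  shows "emeasure (verdict n f D (test_round n T)) {b}
    = (\<integral>\<^sup>+x. \<integral>\<^sup>+y. \<integral>\<^sup>+p. emeasure (round_kernel n f (verdict n f D T) x y p) {b}
        \<partial>D \<partial>std_gaussian n \<partial>std_gaussian n)"
  unfolding verdict_test_round
  by (rule emeasure_bind_round_kernel[OF f D verdict_in_prob_algebra[OF f D assms]])

text \<open>With \<open>Accept\<close> as continuation the round kernel is a point mass, and its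
  mass at \<open>True\<close> is the indicator of passing.\<close>

lemma acceptance_eq: "ennreal acceptance
    = (\<integral>\<^sup>+x. \<integral>\<^sup>+y. \<integral>\<^sup>+p. of_bool (passes n f x y p) \<partial>D \<partial>std_gaussian n \<partial>std_gaussian n)"
proof -
  interpret V: prob_space "verdict n f D (test_round n Accept)"
    by (intro prob_space_verdict well_formed_test_round) simp
  show ?thesis
    unfolding acceptance_def V.emeasure_eq_measure[symmetric]
    by (subst emeasure_verdict_test_round) (auto intro!: nn_integral_cong simp: round_kernel_def)
qed

lemma rejection_eq: "rejection = ennreal (1 - acceptance)"
proof -
  have wf: "well_formed n (test_round n Accept)"
    by (intro well_formed_test_round) simp
  interpret V: prob_space "verdict n f D (test_round n Accept)"
    by (rule prob_space_verdict[OF wf])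
  have "rejection = emeasure (verdict n f D (test_round n Accept)) {False}"
    unfolding rejection_def
    by (subst emeasure_verdict_test_round) (auto intro!: nn_integral_cong simp: round_kernel_def)
  then show ?thesis
    unfolding V.emeasure_eq_measure measure_verdict_False[OF wf] acceptance_def .
qed

lemma acceptance_nonneg: "acceptance \<ge> 0"
  by (simp add: acceptance_def)

text \<open>Independence of the rounds: the law of the continuation does not depend on the draws of
  this round, so its acceptance probability \<open>v\<close> factors out.\<close>

lemma measure_verdict_test_round:
  assumes T: "well_formed n T"
  shows "measure (verdict n f D (test_round n T)) {True} = acceptance * measure (verdict n f D T) {True}"
proof -
  interpret R: prob_space "verdict n f D (test_round n T)"
    by (intro prob_space_verdict well_formed_test_round T)
  interpret V: prob_space "verdict n f D T" by (intro prob_space_verdict T)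
  define v where "v = emeasure (verdict n f D T) {True}"
  \<comment> \<open>The factor \<open>v\<close> leaves the three integrals one at a time, which
    needs measurability at each level.\<close>
  have pass: "(\<lambda>(z, p). of_bool (passes n f (fst z) (snd z) p) :: ennreal)
      \<in> borel_measurable ((std_gaussian n \<Otimes>\<^sub>M std_gaussian n) \<Otimes>\<^sub>M D)"
    unfolding passes_def by measurable
  have pass3: "(\<lambda>p. of_bool (passes n f x y p) :: ennreal) \<in> borel_measurable D"
    if "x \<in> space (std_gaussian n)" "y \<in> space (std_gaussian n)" for x y
    using measurable_Pair2[OF pass, of "(x, y)"] that by (simp add: space_pair_measure)
  have pass_pair: "(\<lambda>(x, y). \<integral>\<^sup>+p. of_bool (passes n f x y p) \<partial>D)
      \<in> borel_measurable (std_gaussian n \<Otimes>\<^sub>M std_gaussian n)"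
    using D.borel_measurable_nn_integral[OF pass] by (simp only: split_beta')
  have pass2: "(\<lambda>y. \<integral>\<^sup>+p. of_bool (passes n f x y p) \<partial>D) \<in> borel_measurable (std_gaussian n)"
    if "x \<in> space (std_gaussian n)" for x
    using measurable_Pair2[OF pass_pair that] by simp
  have pass1: "(\<lambda>x. \<integral>\<^sup>+y. \<integral>\<^sup>+p. of_bool (passes n f x y p) \<partial>D \<partial>std_gaussian n)
      \<in> borel_measurable (std_gaussian n)"
    by (rule G.borel_measurable_nn_integral[OF pass_pair])
  have "emeasure (verdict n f D (test_round n T)) {True}
     = (\<integral>\<^sup>+x. \<integral>\<^sup>+y. \<integral>\<^sup>+p. of_bool (passes n f x y p) * v \<partial>D \<partial>std_gaussian n \<partial>std_gaussian n)"
    by (subst emeasure_verdict_test_round[OF T])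
      (auto intro!: nn_integral_cong simp: round_kernel_def v_def)
  also have "\<dots> = (\<integral>\<^sup>+x. \<integral>\<^sup>+y. (\<integral>\<^sup>+p. of_bool (passes n f x y p) \<partial>D) * v \<partial>std_gaussian n \<partial>std_gaussian n)"
    by (intro nn_integral_cong nn_integral_multc pass3)
  also have "\<dots> = (\<integral>\<^sup>+x. (\<integral>\<^sup>+y. \<integral>\<^sup>+p. of_bool (passes n f x y p) \<partial>D \<partial>std_gaussian n) * v \<partial>std_gaussian n)"
    by (intro nn_integral_cong nn_integral_multc pass2)
  also have "\<dots> = (\<integral>\<^sup>+x. \<integral>\<^sup>+y. \<integral>\<^sup>+p. of_bool (passes n f x y p) \<partial>D \<partial>std_gaussian n \<partial>std_gaussian n) * v"
    by (intro nn_integral_multc pass1)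
  finally show ?thesis
    using acceptance_nonneg
    by (simp add: acceptance_eq[symmetric] v_def R.emeasure_eq_measure V.emeasure_eq_measure
        flip: ennreal_mult)
qed

lemma measure_verdict_funpow:
  "measure (verdict n f D ((test_round n ^^ m) Accept)) {True} = acceptance ^ m"
  by (induction m) (simp_all add: measure_verdict_test_round well_formed_funpow measure_return)

text \<open>Every triple of draws passes, not just almost every one, because the second check only
  uses homogeneity over natural multiples.\<close>

lemma acceptance_additive:
  assumes add: "additive_fun n f"
  shows "acceptance = 1"
proof -
  have fadd: "f (point_add n x y) = f x + f y" if "x \<in> space (Rn n)" "y \<in> space (Rn n)" for x y
    using add that by (simp add: additive_fun_def)
  have fscale: "f (point_scale n (real j * c) p) = real j * f (point_scale n c p)" for j c p
  proof (induction j)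
    case 0
    have "point_add n (point_scale n 0 p) (point_scale n 0 p) = point_scale n 0 p"
      by (simp flip: point_scale_add_left)
    then show ?case using fadd[of "point_scale n 0 p" "point_scale n 0 p"] by simp
  next
    case (Suc j)
    then show ?case
      using fadd[of "point_scale n c p" "point_scale n (real j * c) p"]
      by (simp add: distrib_right point_scale_add_left)
  qed
  have "passes n f x y p" if "x \<in> space (Rn n)" "y \<in> space (Rn n)" "p \<in> space (Rn n)" for x y p
    using that fadd[of x y] fadd[of x "shrink n p"]
      fscale[of "scaling n p" "1 / real (scaling n p)" p]
    by (simp add: passes_def shrink_def point_scale_1)
  then have "ennreal acceptance = (\<integral>\<^sup>+x. \<integral>\<^sup>+y. \<integral>\<^sup>+p. 1 \<partial>D \<partial>std_gaussian n \<partial>std_gaussian n)"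
    unfolding acceptance_eq by (intro nn_integral_cong) (simp add: space_G space_D)
  also have "\<dots> = 1"
    using D.emeasure_space_1 G.emeasure_space_1 by simp
  finally show ?thesis by simp
qed

text \<open>All \<open>m\<close> rounds pass with probability at most (1 - \<epsilon> / 10)^m, which
  is at most exp (- m \<epsilon> / 10).\<close>

lemma measure_verdict_far:
  assumes \<epsilon>: "\<epsilon> > 0" and far: "eps_far n (additive_fun n) D \<epsilon> f" and m: "real m \<ge> 20 / \<epsilon>"
  shows "measure (verdict n f D ((test_round n ^^ m) Accept)) {False} \<ge> 2 / 3"
proof -
  have "ennreal (\<epsilon> / 10) \<le> ennreal (1 - acceptance)"
    using rejection_ge[OF \<epsilon> far] by (simp add: rejection_eq)
  then have "acceptance \<le> 1 - \<epsilon> / 10"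
    using \<epsilon> by (subst (asm) ennreal_le_iff2) auto
  also have "\<dots> \<le> exp (- (\<epsilon> / 10))"
    using exp_ge_add_one_self[of "- (\<epsilon> / 10)"] by linarith
  finally have "acceptance ^ m \<le> exp (- (\<epsilon> / 10)) ^ m"
    by (intro power_mono acceptance_nonneg)
  also have "\<dots> = exp (- (real m * \<epsilon> / 10))"
    by (simp flip: exp_of_nat_mult)
  also have "\<dots> \<le> exp (- 2)"
    using m \<epsilon> by (simp add: field_simps)
  \<comment> \<open>exp 2 \<ge> 1 + 2 = 3; this is where the constant 20 in the number of rounds
    comes from.\<close>
  also have "\<dots> \<le> 1 / 3"
    using exp_ge_add_one_self[of 2] by (simp add: exp_minus field_simps)
  finally show ?thesis
    by (simp add: measure_verdict_False[OF well_formed_funpow] measure_verdict_funpow)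
qed

end

section \<open>Query count and choice of parameters\<close>

lemma query_complexity_funpow:
  "query_complexity ((test_round n ^^ m) Accept) \<le> enat (5 * m)"
proof (induction m)
  case (Suc m)
  have "query_complexity ((test_round n ^^ Suc m) Accept) \<le> 5 + enat (5 * m)"
    using query_complexity_test_round[of n "(test_round n ^^ m) Accept"] Suc
    by (simp add: order_trans[OF _ add_left_mono])
  then show ?case by (simp add: numeral_eq_enat)
qed (simp add: zero_enat_def)

text \<open>For \<epsilon> < 1 the ceiling is at most 20 / \<epsilon> + 1, hence at most 21 /
  \<epsilon>, and 105 = 5 * 21.\<close>

lemma query_bound_bigo:
  "(\<lambda>\<epsilon>. real (5 * nat \<lceil>20 / \<epsilon>\<rceil>)) \<in> O[at_right 0](\<lambda>\<epsilon>. 1 / \<epsilon> * ln (1 / \<epsilon>))"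
proof (rule bigoI[where c = 105])
  \<comment> \<open>Below exp (-1) the logarithm of 1 / \<epsilon> is at least 1, so a bound linear
    in 1 / \<epsilon> is enough.\<close>
  have "eventually (\<lambda>\<epsilon>::real. 0 < \<epsilon> \<and> \<epsilon> < exp (- 1)) (at_right 0)"
    by (auto simp: eventually_at_right_field intro!: exI[of _ "exp (- 1)"])
  then show "eventually (\<lambda>\<epsilon>::real. norm (real (5 * nat \<lceil>20 / \<epsilon>\<rceil>)) \<le> 105 * norm (1 / \<epsilon> * ln (1 / \<epsilon>))) (at_right 0)"
  proof eventually_elim
    fix \<epsilon> :: real assume \<epsilon>: "0 < \<epsilon> \<and> \<epsilon> < exp (- 1)"
    then have "\<epsilon> < 1" by (smt (verit) exp_le_one_iff)
    have "ln \<epsilon> < ln (exp (- 1))" using \<epsilon> by (subst ln_less_cancel_iff) auto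
    then have ln: "ln (1 / \<epsilon>) \<ge> 1" using \<epsilon> by (simp add: ln_div)
    have "real (nat \<lceil>20 / \<epsilon>\<rceil>) \<le> 20 / \<epsilon> + 1"
      using \<epsilon> by (simp add: of_nat_nat)
    then have "real (nat \<lceil>20 / \<epsilon>\<rceil>) \<le> 20 * (1 / \<epsilon>) + 1"
      by simp
    moreover have "1 \<le> 1 / \<epsilon>" using \<epsilon> \<open>\<epsilon> < 1\<close> by simp
    ultimately have "real (5 * nat \<lceil>20 / \<epsilon>\<rceil>) \<le> 105 * (1 / \<epsilon>)"
      unfolding of_nat_mult of_nat_numeral by linarith
    also have "\<dots> \<le> 105 * (1 / \<epsilon> * ln (1 / \<epsilon>))"
      using ln \<epsilon> mult_left_mono[OF ln, of "1 / \<epsilon>"] by simp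
    finally show "norm (real (5 * nat \<lceil>20 / \<epsilon>\<rceil>)) \<le> 105 * norm (1 / \<epsilon> * ln (1 / \<epsilon>))"
      using mult_nonneg_nonneg[of "1 / \<epsilon>" "ln (1 / \<epsilon>)"] ln \<epsilon> by (simp only: real_norm_def abs_of_nonneg)
  qed
qed

theorem theorem1p1:
  shows "\<exists>q :: real \<Rightarrow> nat.
    (\<lambda>\<epsilon>. real (q \<epsilon>)) \<in> O[at_right 0](\<lambda>\<epsilon>. 1 / \<epsilon> * ln (1 / \<epsilon>)) \<and>
    (\<forall>n. \<exists>A :: real \<Rightarrow> algorithm.
       distribution_free_tester n (additive_fun n) A \<and>
       one_sided_error n (additive_fun n) A \<and>
       (\<forall>\<epsilon>>0. query_complexity (A \<epsilon>) \<le> enat (q \<epsilon>)))"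
proof (intro exI conjI allI impI)
  \<comment> \<open>This instantiates \<open>q\<close> before \<open>n\<close> is fixed: five
    queries in each of the \<lceil>20 / \<epsilon>\<rceil> rounds.\<close>
  show "(\<lambda>\<epsilon>. real (5 * nat \<lceil>20 / \<epsilon>\<rceil>)) \<in> O[at_right 0](\<lambda>\<epsilon>. 1 / \<epsilon> * ln (1 / \<epsilon>))"
    by (rule query_bound_bigo)
next
  fix n
  let ?A = "\<lambda>\<epsilon> :: real. (test_round n ^^ nat \<lceil>20 / \<epsilon>\<rceil>) Accept"
  have accept: "measure (verdict n f D (?A \<epsilon>)) {True} = 1"
    if "f \<in> borel_measurable (Rn n)" "D \<in> space (prob_algebra (Rn n))" "additive_fun n f" for f D \<epsilon>
    using that by (simp add: measure_verdict_funpow acceptance_additive)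
  then show "one_sided_error n (additive_fun n) ?A"
    by (simp add: one_sided_error_def)
  show "distribution_free_tester n (additive_fun n) ?A"
    unfolding distribution_free_tester_def
  proof (intro allI impI conjI ballI)
    fix \<epsilon> :: real and f :: "point \<Rightarrow> real" and D
    assume \<epsilon>: "\<epsilon> > 0" and fD: "f \<in> borel_measurable (Rn n)" "D \<in> space (prob_algebra (Rn n))"
    show "2 / 3 \<le> measure (verdict n f D (?A \<epsilon>)) {True}" if "additive_fun n f"
      using accept[OF fD that, of \<epsilon>] by simp
    show "2 / 3 \<le> measure (verdict n f D (?A \<epsilon>)) {False}" if "eps_far n (additive_fun n) D \<epsilon> f"
      by (rule measure_verdict_far[OF fD \<epsilon> that real_nat_ceiling_ge])
  qed (rule well_formed_funpow)
  show "query_complexity (?A \<epsilon>) \<le> enat (5 * nat \<lceil>20 / \<epsilon>\<rceil>)" if "\<epsilon> > 0" for \<epsilon>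
    by (rule query_complexity_funpow)
qed

end
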